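(* Let $\mathbb F$ be an infinite field of characteristic $p>0$ with $p\nmid 2$, and let $R=\mathbb F[[X,Y,Z]]/(X^2+Y^2+Z^2)$. Then $R$ is $F$-rational.
   Context: A Noetherian local ring $R$ of prime characteristic $p$ is $F$-rational if every ideal of the principal class (generated by as many elements as its height) is tightly closed, i.e. equals its tight closure. The tight closure $J^*$ of an ideal $J$ consists of all $x\in R$ such that there is $c\in R$, not in any minimal prime, with $cx^q\in J^{[q]}$ for all sufficiently large $q=p^e$, where $J^{[q]}$ is generated by the $q$-th powers of elements of $J$. *)

theory Defs
  imports
    "HOL-Algebra.Algebra"
    "HOL-Algebra.Algebraic_Closure_Type"
    "HOL-Library.Extended_Nat"
begin

section \<open>Prime spectrum and height\<close>

definition minimal_prime :: "('a, 'b) ring_scheme \<Rightarrow> 'a set \<Rightarrow> bool" where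
  "minimal_prime R P \<longleftrightarrow>
     primeideal P R \<and> (\<forall>Q. primeideal Q R \<longrightarrow> Q \<subseteq> P \<longrightarrow> Q = P)"

definition prime_height :: "('a, 'b) ring_scheme \<Rightarrow> 'a set \<Rightarrow> enat" where
  "prime_height R P =
     Sup {enat n | n. \<exists>C :: nat \<Rightarrow> 'a set.
       (\<forall>i\<le>n. primeideal (C i) R) \<and> (\<forall>i<n. C i \<subset> C (Suc i)) \<and> C n = P}"

text \<open>
  The unit ideal lies in no prime ideal and so gets height \<open>\<infinity>\<close>; it is never an ideal of the
  principal class.
\<close>

definition ideal_height :: "('a, 'b) ring_scheme \<Rightarrow> 'a set \<Rightarrow> enat" where
  "ideal_height R I = Inf {prime_height R P | P. primeideal P R \<and> I \<subseteq> P}"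

definition principal_class :: "('a, 'b) ring_scheme \<Rightarrow> 'a set \<Rightarrow> bool" where
  "principal_class R I \<longleftrightarrow>
     (\<exists>xs. set xs \<subseteq> carrier R \<and> I = Idl\<^bsub>R\<^esub> (set xs) \<and> ideal_height R I = enat (length xs))"


section \<open>Tight closure and F-rationality\<close>

definition has_char :: "('a, 'b) ring_scheme \<Rightarrow> nat \<Rightarrow> bool" where
  "has_char R p \<longleftrightarrow> (\<forall>n::nat. [n] \<cdot>\<^bsub>R\<^esub> \<one>\<^bsub>R\<^esub> = \<zero>\<^bsub>R\<^esub> \<longleftrightarrow> p dvd n)"

definition frobenius_power :: "('a, 'b) ring_scheme \<Rightarrow> nat \<Rightarrow> 'a set \<Rightarrow> 'a set" where
  "frobenius_power R q J = Idl\<^bsub>R\<^esub> ((\<lambda>x. x [^]\<^bsub>R\<^esub> q) ` J)"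

text \<open>Below, \<open>p\<close> is meant to be the (prime) characteristic of \<open>R\<close>.\<close>

definition tight_closure :: "('a, 'b) ring_scheme \<Rightarrow> nat \<Rightarrow> 'a set \<Rightarrow> 'a set" where
  "tight_closure R p J =
     {x \<in> carrier R.
        \<exists>c \<in> carrier R. (\<forall>P. minimal_prime R P \<longrightarrow> c \<notin> P) \<and>
          (\<exists>N. \<forall>e\<ge>N. c \<otimes>\<^bsub>R\<^esub> x [^]\<^bsub>R\<^esub> (p ^ e) \<in> frobenius_power R (p ^ e) J)}"

definition local_ring :: "('a, 'b) ring_scheme \<Rightarrow> bool" where
  "local_ring R \<longleftrightarrow> cring R \<and> (\<exists>!M. maximalideal M R)"

definition F_rational :: "('a, 'b) ring_scheme \<Rightarrow> nat \<Rightarrow> bool" where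
  "F_rational R p \<longleftrightarrow>
     noetherian_ring R \<and> local_ring R \<and> Factorial_Ring.prime p \<and> has_char R p \<and>
     (\<forall>I. principal_class R I \<longrightarrow> tight_closure R p I = I)"


section \<open>The quadric\<close>

text \<open>
  The ring of power series in three variables over a field \<open>'a\<close> is rendered as the iterated power
  series type \<open>'a fps fps fps\<close>: the outermost layer is the variable \<open>Z\<close>, the innermost one is \<open>X\<close>.
  The lemmas \<open>fps3_add_nth\<close>, \<open>fps3_mult_nth\<close>, \<open>fps3_monomial_nth\<close> and \<open>fps3_bij\<close> show that, via
  coefficients, this is the usual ring of families indexed by exponent triples with the Cauchy
  product.
\<close>

definition fps3_nth :: "'a fps fps fps \<Rightarrow> nat \<Rightarrow> nat \<Rightarrow> nat \<Rightarrow> 'a" where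
  "fps3_nth f i j k = fps_nth (fps_nth (fps_nth f k) j) i"

definition var_X :: "'a::comm_ring_1 fps fps fps" where
  "var_X = fps_const (fps_const fps_X)"

definition var_Y :: "'a::comm_ring_1 fps fps fps" where
  "var_Y = fps_const fps_X"

definition var_Z :: "'a::comm_ring_1 fps fps fps" where
  "var_Z = fps_X"

lemma fps3_bij:
  "bij (fps3_nth :: 'a::comm_ring_1 fps fps fps \<Rightarrow> nat \<Rightarrow> nat \<Rightarrow> nat \<Rightarrow> 'a)"
proof (rule bijI)
  show "inj (fps3_nth :: 'a fps fps fps \<Rightarrow> _)"
    by (rule injI) (auto simp: fps3_nth_def fps_eq_iff fun_eq_iff)
  show "surj (fps3_nth :: 'a fps fps fps \<Rightarrow> _)"
  proof (rule surjI)
    fix a :: "nat \<Rightarrow> nat \<Rightarrow> nat \<Rightarrow> 'a"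
    show "fps3_nth (Abs_fps (\<lambda>k. Abs_fps (\<lambda>j. Abs_fps (\<lambda>i. a i j k)))) = a"
      by (simp add: fps3_nth_def fun_eq_iff)
  qed
qed

lemma fps3_add_nth: "fps3_nth (f + g) i j k = fps3_nth f i j k + fps3_nth g i j k"
  for f g :: "'a::comm_ring_1 fps fps fps"
  by (simp add: fps3_nth_def)

lemma fps3_mult_nth:
  "fps3_nth (f * g) i j k =
     (\<Sum>c=0..k. \<Sum>b=0..j. \<Sum>a=0..i. fps3_nth f a b c * fps3_nth g (i - a) (j - b) (k - c))"
  for f g :: "'a::comm_ring_1 fps fps fps"
  by (simp add: fps3_nth_def fps_mult_nth fps_sum_nth)

lemma fps3_monomial_nth:
  "fps3_nth (var_X ^ a * var_Y ^ b * var_Z ^ c) i j k =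
     (if i = a \<and> j = b \<and> k = c then 1 else (0::'a::comm_ring_1))"
  by (simp add: fps3_nth_def var_X_def var_Y_def var_Z_def fps_const_power
      fps_X_power_mult_right_nth fps_X_power_nth mult.assoc)

definition quadric_ring :: "'a::comm_ring_1 fps fps fps set ring" where
  "quadric_ring =
     (let S = ring_of_type_algebra
      in S Quot (Idl\<^bsub>S\<^esub> {var_X ^ 2 + var_Y ^ 2 + var_Z ^ 2}))"

end

theory Submission
  imports Defs
begin

text \<open>
  Write \<open>P = F[[X,Y,Z]]\<close>, \<open>Q = X\<^sup>2 + Y\<^sup>2 + Z\<^sup>2\<close> and \<open>q = p\<^sup>e = 2h + 1\<close>. The ring \<open>P/(Q)\<close> is strongly
  F-regular by Glassbrenner's criterion: if \<open>Q\<close> does not divide \<open>f\<close>, then for large \<open>e\<close> some monomial with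
  all exponents below \<open>q\<close> occurs in \<open>f Q\<^sup>q\<^sup>-\<^sup>1\<close>. Extracting the corresponding coefficient of
  \<open>g Q\<^sup>q\<^sup>-\<^sup>1\<close> over the subring of \<open>q\<close>-th powers gives an additive map \<open>T\<close> with
  \<open>T (g y\<^sup>q) = T g y\<close> that preserves \<open>(Q)\<close> and, after scaling, maps \<open>f\<close> to \<open>1\<close> modulo \<open>Q\<close>. Applied to a
  relation \<open>f x\<^sup>q \<in> I\<^sup>[\<^sup>q\<^sup>]\<close> it yields \<open>x \<in> I\<close>, so every ideal of \<open>P/(Q)\<close>, whatever its height, is
  tightly closed; applied to \<open>f x\<^sup>q = 0\<close> it shows that \<open>P/(Q)\<close> is a domain.

  For the monomial, reduce \<open>f\<close> to \<open>a + b Z\<close> modulo \<open>Q\<close> and put \<open>D = X\<^sup>2 + Y\<^sup>2\<close>. The coefficients of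
  \<open>Z\<^sup>q\<^sup>-\<^sup>1\<close> and (if \<open>a = 0\<close>) \<open>Z\<^sup>q\<^sup>-\<^sup>2\<close> are \<open>\<plusminus> a D\<^sup>h\<close> and \<open>\<plusminus> b D\<^sup>h\<^sup>+\<^sup>1\<close>. Passing to lowest forms and setting
  \<open>Y = 1\<close>, what has to be excluded is \<open>a (x\<^sup>2 + 1)\<^sup>h\<^sup>+\<^sup>1 = l + x\<^sup>q m\<close> for a polynomial \<open>a \<noteq> 0\<close> and
  polynomials \<open>l\<close>, \<open>m\<close> of small degree.
\<close>

section \<open>Maps inverse to the Frobenius\<close>

text \<open>For \<open>q = p^e\<close> these are the Cartier maps: linear from the ring, with
  scalars acting through their \<open>q\<close>-th powers, to the ring itself.\<close>

definition frobenius_linear :: "nat \<Rightarrow> ('b::comm_ring_1 \<Rightarrow> 'b) \<Rightarrow> bool" where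
  "frobenius_linear q T \<longleftrightarrow>
     (\<forall>x y. T (x + y) = T x + T y) \<and> (\<forall>x y. T (x * y ^ q) = T x * y)"

lemma frobenius_linear_add: "frobenius_linear q T \<Longrightarrow> T (x + y) = T x + T y"
  and frobenius_linear_mult_power: "frobenius_linear q T \<Longrightarrow> T (x * y ^ q) = T x * y"
  by (auto simp: frobenius_linear_def)

lemma frobenius_linear_zero:
  assumes "frobenius_linear q T" shows "T 0 = 0"
  using frobenius_linear_add[OF assms, of 0 0] by simp

text \<open>A nonzero \<open>a\<close> is independent for the field acting through
  \<open>q\<close>-th powers, so some linear functional takes the value 1 on it.\<close>

lemma frobenius_linear_field:
  fixes a :: "'a::field"
  assumes p: "CHAR('a) > 0" and a: "a \<noteq> 0"
  shows "\<exists>T. frobenius_linear (CHAR('a) ^ e) T \<and> T a = 1"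
proof -
  define q where "q = CHAR('a) ^ e"
  have prime: "Factorial_Ring.prime CHAR('a)"
    using p by (rule prime_CHAR_semidom)
  interpret V: vector_space_pair "\<lambda>c x :: 'a. c ^ q * x" "(*) :: 'a \<Rightarrow> 'a \<Rightarrow> 'a"
    by unfold_locales
       (auto simp: algebra_simps q_def freshmans_dream'[OF prime refl] power_mult_distrib)
  have "V.vs1.independent {a}"
    using a by (simp add: V.vs1.dependent_single)
  then obtain T where T: "Vector_Spaces.linear (\<lambda>c x :: 'a. c ^ q * x) (*) T" "\<forall>x\<in>{a}. T x = 1"
    using V.linear_independent_extend[of "{a}" "\<lambda>_. 1"] by blast
  interpret T: Vector_Spaces.linear "\<lambda>c x :: 'a. c ^ q * x" "(*)" T by fact
  have "T (x * y ^ q) = T x * y" for x y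
    using T.scale[of y x] by (simp add: mult.commute)
  thus ?thesis
    using T(2) by (intro exI[of _ T]) (simp add: frobenius_linear_def T.add flip: q_def)
qed

lemma fps_split_const_X: "f = fps_const (f $ 0) + fps_X * fps_shift 1 f"
  for f :: "'b::comm_ring_1 fps"
  by (rule fps_ext) (simp add: fps_X_mult_nth)

text \<open>Over the series in \<open>X^q\<close>, the powers \<open>X^c\<close> with
  \<open>c < q\<close> form a basis. This takes the coordinate at \<open>X^c\<close>, replaces
  \<open>X^q\<close> by \<open>X\<close> and applies \<open>T\<close> to coefficients.\<close>

definition fps_frobenius_trace :: "nat \<Rightarrow> nat \<Rightarrow> ('b::comm_ring_1 \<Rightarrow> 'b) \<Rightarrow> 'b fps \<Rightarrow> 'b fps" where
  "fps_frobenius_trace q c T f = Abs_fps (\<lambda>n. T (f $ (c + q * n)))"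

lemma frobenius_linear_fps_frobenius_trace:
  fixes T :: "'b::comm_ring_1 \<Rightarrow> 'b"
  assumes T: "frobenius_linear q T" and c: "c < q"
    and q: "q = CHAR('b) ^ e" and prime: "Factorial_Ring.prime CHAR('b)"
  shows "frobenius_linear q (fps_frobenius_trace q c T)"
proof -
  let ?U = "fps_frobenius_trace q c T"
  have add: "?U (f + g) = ?U f + ?U g" for f g
    by (rule fps_ext) (simp add: fps_frobenius_trace_def frobenius_linear_add[OF T])
  have const: "?U (f * fps_const x ^ q) = ?U f * fps_const x" for f x
    by (rule fps_ext)
       (simp add: fps_frobenius_trace_def fps_const_power frobenius_linear_mult_power[OF T])
  have X: "?U (f * fps_X ^ q) = ?U f * fps_X" for f
  proof (rule fps_ext)
    fix n show "?U (f * fps_X ^ q) $ n = (?U f * fps_X) $ n"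
      using c frobenius_linear_zero[OF T]
      by (cases n) (simp_all add: fps_frobenius_trace_def fps_X_power_mult_right_nth)
  qed
  \<comment> \<open>This passes from constants and \<open>X\<close> to all series: the defect for
    \<open>g\<close> is \<open>X\<close> times the defect for its tail \<open>g'\<close>, so its
    coefficients vanish one after another.\<close>
  have "(?U (f * g ^ q) - ?U f * g) $ n = 0" for f g n
  proof (induction n arbitrary: f g rule: less_induct)
    case (less n)
    define g' where "g' = fps_shift 1 g"
    have g: "g = fps_const (g $ 0) + fps_X * g'"
      unfolding g'_def by (rule fps_split_const_X)
    have "g ^ q = fps_const (g $ 0) ^ q + fps_X ^ q * g' ^ q"
      by (subst g) (use prime in \<open>simp add: q freshmans_dream' power_mult_distrib\<close>)
    hence "?U (f * g ^ q) = ?U (f * fps_const (g $ 0) ^ q + f * g' ^ q * fps_X ^ q)"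
      by (simp add: algebra_simps)
    also have "\<dots> = ?U f * fps_const (g $ 0) + ?U (f * g' ^ q) * fps_X"
      by (simp only: add const X)
    finally have "?U (f * g ^ q) - ?U f * g = fps_X * (?U (f * g' ^ q) - ?U f * g')"
      by (subst (2) g) (simp add: algebra_simps)
    thus ?case
      using less[of "n - 1"] by (cases n) simp_all
  qed
  thus ?thesis
    by (simp add: frobenius_linear_def add fps_eq_iff)
qed

text \<open>The trace at \<open>c\<close> sends \<open>f\<close> to a series with constant term 1;
  multiplying all values by the inverse of that series normalises the value at
  \<open>f\<close>.\<close>

lemma frobenius_linear_fps:
  fixes T :: "'b::comm_ring_1 \<Rightarrow> 'b"
  assumes T: "frobenius_linear q T" "T (f $ c) = 1" and c: "c < q"
    and q: "q = CHAR('b) ^ e" and prime: "Factorial_Ring.prime CHAR('b)"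
  shows "\<exists>U. frobenius_linear q U \<and> U f = 1"
proof -
  define U where "U = fps_frobenius_trace q c T"
  define v where "v = fps_right_inverse (U f) 1"
  have U: "frobenius_linear q U"
    unfolding U_def by (rule frobenius_linear_fps_frobenius_trace[OF T(1) c q prime])
  have "U f $ 0 = 1" by (simp add: U_def fps_frobenius_trace_def T)
  hence "U f * v = 1" unfolding v_def by (intro fps_right_inverse) simp
  thus ?thesis
    using U by (intro exI[of _ "\<lambda>g. U g * v"]) (auto simp: frobenius_linear_def algebra_simps)
qed

lemma frobenius_linear_fps3:
  fixes f :: "'a::field fps fps fps"
  assumes "CHAR('a) > 0" and "fps3_nth f i j k \<noteq> 0"
    and "i < CHAR('a) ^ e" and "j < CHAR('a) ^ e" and "k < CHAR('a) ^ e"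
  shows "\<exists>T. frobenius_linear (CHAR('a) ^ e) T \<and> T f = 1"
proof -
  have prime: "Factorial_Ring.prime CHAR('a)" using assms(1) by (rule prime_CHAR_semidom)
  obtain T where T: "frobenius_linear (CHAR('a) ^ e) T" "T (f $ k $ j $ i) = 1"
    using frobenius_linear_field[OF assms(1,2)] unfolding fps3_nth_def by blast
  obtain U where U: "frobenius_linear (CHAR('a) ^ e) U" "U (f $ k $ j) = 1"
    using frobenius_linear_fps[OF T assms(3) refl prime] by blast
  obtain V where V: "frobenius_linear (CHAR('a) ^ e) V" "V (f $ k) = 1"
    using frobenius_linear_fps[OF U assms(4), of e] prime by auto
  show ?thesis
    using frobenius_linear_fps[OF V assms(5), of e] prime by auto
qed


section \<open>Powers of the quadric\<close>

text \<open>For \<open>j = d + 2 * h + 2 - i\<close>, the range of \<open>i\<close> says that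
  \<open>i\<close> and \<open>j\<close> are both below \<open>q = 2 * h + 1\<close>. If all these
  coefficients vanished, the product would be \<open>l + x^q m\<close> with \<open>l\<close>,
  \<open>m\<close> of degree at most \<open>d + 1\<close>, and \<open>m\<close> would get a zero of
  order above its degree.\<close>

lemma coeff_mult_sum_squares_power_nonzero:
  fixes a :: "'a::field poly"
  assumes p: "CHAR('a) > 0" and q: "CHAR('a) ^ e = 2 * h + 1" and h: "d < h"
    and a: "a \<noteq> 0" "degree a \<le> d"
  shows "\<exists>i. d + 1 < i \<and> i < 2 * h + 1 \<and> coeff (a * [:1, 0, 1:] ^ (h + 1)) i \<noteq> 0"
proof (rule ccontr)
  assume neg: "\<not> ?thesis"
  define w :: "'a poly" where "w = [:1, 0, 1:]"
  define q where "q = 2 * h + 1"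
  define x :: "'a poly" where "x = monom 1 1"
  define u where "u = a * w ^ (h + 1)"
  define l where "l = poly_cutoff (d + 2) u"
  define m where "m = poly_shift q u"
  have prime: "Factorial_Ring.prime CHAR('a poly)"
    using p by (simp add: prime_CHAR_semidom)
  have frob: "(f + g) ^ q = f ^ q + g ^ q" for f g :: "'a poly"
    using freshmans_dream'[OF prime, of q e] q by (simp add: q_def)
  have w0: "w \<noteq> 0" and degw: "degree (w ^ n) = 2 * n" for n
    by (auto simp: w_def degree_power_eq)
  have degu: "degree u \<le> d + 1 + q"
    using a w0 by (simp add: u_def degree_mult_eq degw q_def del: power_Suc)
  have coeffu: "coeff u n = 0" if "d + 1 < n" "n < q" for n
    using neg that by (auto simp: u_def w_def q_def)
  have xq: "x ^ q = monom 1 q" by (simp add: x_def monom_power)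
  have dq: "d + 1 < q" using h by (simp add: q_def)
  have u_eq: "u = l + x ^ q * m"
  proof (rule poly_eqI)
    fix n show "coeff u n = coeff (l + x ^ q * m) n"
      using coeffu[of n] dq
      by (auto simp: l_def m_def xq coeff_monom_mult coeff_poly_shift coeff_poly_cutoff)
  qed
  have degl: "degree l \<le> d + 1"
    by (rule degree_le) (simp add: l_def coeff_poly_cutoff)
  have degm: "degree m \<le> d + 1"
    by (rule degree_le) (use degu in \<open>auto simp: m_def coeff_poly_shift intro!: coeff_eq_0\<close>)
  have wx: "w = x ^ 2 + 1"
    by (simp add: w_def x_def monom_altdef one_pCons power2_eq_square)
  have wq: "w ^ q = x ^ (2 * q) + 1"
    by (simp add: wx frob power_mult)
  txt \<open>
    Since \<open>x\<^sup>2\<^sup>q \<equiv> -1\<close> modulo \<open>w\<^sup>q\<close>, multiplying by \<open>l - x\<^sup>q m\<close> gives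
    \<open>l\<^sup>2 + m\<^sup>2 \<equiv> 0\<close> modulo \<open>w\<^sup>h\<^sup>+\<^sup>1\<close>, where the degrees force equality; so \<open>-1\<close> is a square unless \<open>m = 0\<close>.
  \<close>
  have wdvd: "w ^ (h + 1) dvd l + x ^ q * m"
    unfolding u_eq[symmetric] u_def by simp
  have "w ^ (h + 1) dvd (l + x ^ q * m) * (l - x ^ q * m) + w ^ q * m ^ 2"
    by (intro dvd_add dvd_mult2 wdvd le_imp_power_dvd) (simp add: q_def)
  also have "(l + x ^ q * m) * (l - x ^ q * m) + w ^ q * m ^ 2 = l ^ 2 + m ^ 2"
    unfolding wq by (simp add: algebra_simps power2_eq_square power_mult mult_2 power_add)
  finally have "w ^ (h + 1) dvd l ^ 2 + m ^ 2" .
  moreover have "degree (l ^ 2 + m ^ 2) < degree (w ^ (h + 1))"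
  proof -
    have "degree (l ^ 2) \<le> 2 * (d + 1)" "degree (m ^ 2) \<le> 2 * (d + 1)"
      using degree_power_le[of l 2] degree_power_le[of m 2] degl degm by auto
    hence "degree (l ^ 2 + m ^ 2) \<le> 2 * (d + 1)" by (rule degree_add_le)
    thus ?thesis using h by (simp only: degw) simp
  qed
  ultimately have lm: "l ^ 2 + m ^ 2 = 0"
    using dvd_imp_degree_le leD by blast
  have u0: "u \<noteq> 0" using a w0 by (simp add: u_def)
  have m0: "m \<noteq> 0" using lm u0 u_eq by auto
  define i where "i = lead_coeff l / lead_coeff m"
  have "lead_coeff (l ^ 2) = lead_coeff (- (m ^ 2))"
    using lm by (simp add: add_eq_0_iff2)
  hence i: "i ^ 2 = -1"
    using m0 by (simp add: i_def lead_coeff_power power_divide lead_coeff_minus divide_eq_eq)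
  have "(l - smult i m) * (l + smult i m) = l ^ 2 - smult (i ^ 2) (m ^ 2)"
    by (simp add: algebra_simps power2_eq_square)
  also have "\<dots> = 0" using lm by (simp add: i)
  finally have "l = smult i m \<or> l = smult (-i) m"
    by (auto simp: add_eq_0_iff2)
  then obtain j where j: "j ^ 2 = -1" "l = smult j m"
    using i by (metis power2_minus)
  \<comment> \<open>\<open>s\<close> is a \<open>q\<close>-th root of \<open>j\<close>: as
    \<open>q = 2 * h + 1\<close>, \<open>j^q = (-1)^h * j\<close>, and the sign in \<open>s\<close>
    cancels this one.\<close>
  define s where "s = (-1) ^ h * j"
  have s2: "s ^ 2 = -1"
    by (simp add: s_def j power_mult_distrib flip: power_mult)
  have "j ^ q = (-1) ^ h * j"
    by (simp add: q_def power_add power_mult j)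
  hence sq: "s ^ q = j"
    unfolding s_def power_mult_distrib by (cases "even h") (simp_all add: q_def)
  \<comment> \<open>In characteristic 2 an odd \<open>q\<close> means \<open>e = 0\<close>, so
    \<open>h = 0\<close>, against \<open>d < h\<close>.\<close>
  have two: "(2 :: 'a) \<noteq> 0"
  proof
    assume "(2 :: 'a) = 0"
    hence "CHAR('a) dvd 2"
      by (metis of_nat_eq_0_iff_char_dvd of_nat_numeral)
    hence "CHAR('a) = 2"
      using prime primes_dvd_imp_eq[OF _ two_is_prime_nat] by simp
    hence "(2 :: nat) ^ e = 2 * h + 1" using q by simp
    hence "odd ((2 :: nat) ^ e)" by simp
    hence "e = 0" by simp
    thus False using q h by simp
  qed
  have s0: "s \<noteq> 0" using s2 by auto
  \<comment> \<open>Since \<open>s\<close> and \<open>-s\<close> differ, the factor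
    \<open>(x - s)^(h + 1)\<close> of \<open>w^(h + 1)\<close> is coprime to
    \<open>(x + s)^q\<close> and must divide \<open>m\<close>, whose degree is at most
    \<open>h\<close>.\<close>
  have "l + x ^ q * m = m * (x + [:s:]) ^ q"
    by (simp add: frob j poly_const_pow sq algebra_simps)
  hence "w ^ (h + 1) dvd m * (x + [:s:]) ^ q" using wdvd by simp
  moreover have "x + [:s:] = [:s, 1:]" by (simp add: x_def monom_altdef)
  moreover have "w = [:-s, 1:] * [:s, 1:]"
    using s2 by (simp add: w_def power2_eq_square)
  hence "[:-s, 1:] ^ (h + 1) dvd w ^ (h + 1)"
    by (simp only: power_mult_distrib dvd_triv_left)
  ultimately have "[:-s, 1:] ^ (h + 1) dvd m * [:s, 1:] ^ q"
    using dvd_trans by simp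
  hence "h + 1 \<le> order s (m * [:s, 1:] ^ q)"
    using m0 by (subst (asm) order_divides) auto
  also have "\<dots> = order s m"
    using m0 two s0 by (subst order_mult) (auto intro!: order_0I)
  also have "\<dots> \<le> degree m" using m0 by (rule order_degree)
  finally show False using degm h by simp
qed

section \<open>Lowest forms in two variables\<close>

definition sum_squares_XY :: "'a::comm_ring_1 fps fps" where
  "sum_squares_XY = fps_const (fps_X ^ 2) + fps_X ^ 2"

lemma mult_sum_squares_XY_nth:
  "(f * sum_squares_XY) $ j $ i =
     (if i < 2 then 0 else f $ j $ (i - 2)) + (if j < 2 then 0 else f $ (j - 2) $ i)"
  by (simp add: sum_squares_XY_def distrib_left fps_X_power_mult_right_nth)

text \<open>Trades a nonzero coefficient of \<open>a * sum_squares_XY ^ (h + 1)\<close> for one of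
  \<open>a * sum_squares_XY ^ h\<close> without raising exponents.\<close>

lemma mult_sum_squares_XY_nth_nonzero:
  assumes "(f * sum_squares_XY) $ j $ i \<noteq> 0"
  obtains i' j' where "i' \<le> i" "j' \<le> j" "f $ j' $ i' \<noteq> 0"
proof -
  have "f $ j $ (i - 2) \<noteq> 0 \<or> f $ (j - 2) $ i \<noteq> 0"
    using assms by (auto simp: mult_sum_squares_XY_nth split: if_splits)
  thus ?thesis by (meson that diff_le_self order_refl)
qed

text \<open>\<open>P\<close> is the form of degree \<open>d\<close> in \<open>f\<close> with
  \<open>Y\<close> set to 1, so multiplying \<open>f\<close> by \<open>X^2 + Y^2\<close> multiplies
  \<open>P\<close> by \<open>x^2 + 1\<close>.\<close>

lemma lowest_form_mult_sum_squares_XY_power: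
  assumes "\<And>i j. i + j < d \<Longrightarrow> f $ j $ i = 0"
    and "\<And>i j. i + j = d \<Longrightarrow> f $ j $ i = coeff P i" and "degree P \<le> d"
  shows "\<And>i j. i + j = d + 2 * n \<Longrightarrow> (f * sum_squares_XY ^ n) $ j $ i = coeff (P * [:1, 0, 1:] ^ n) i"
    and "\<And>i j. i + j < d + 2 * n \<Longrightarrow> (f * sum_squares_XY ^ n) $ j $ i = 0"
    and "degree (P * [:1, 0, 1:] ^ n) \<le> d + 2 * n"
proof (induction n)
  case (Suc n)
  have coeff: "coeff (q * [:1, 0, 1:]) i = coeff q i + (if i < 2 then 0 else coeff q (i - 2))" for q :: "'a poly" and i
    by (auto simp: coeff_pCons split: nat.splits)
  {
    case 1
    \<comment> \<open>Here \<open>i > d + 2 * n\<close>, so the degree bound matches the absent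
      coefficient at \<open>j - 2\<close>.\<close>
    have "coeff (P * [:1, 0, 1:] ^ n) i = 0" if "j < 2"
      using 1 that Suc.IH(3) by (intro coeff_eq_0) auto
    moreover have "i - 2 + j = d + 2 * n" if "\<not> i < 2"
      using 1 that by simp
    moreover have "i + (j - 2) = d + 2 * n" if "\<not> j < 2"
      using 1 that by simp
    ultimately show ?case
      by (simp only: power_Suc2 mult.assoc[symmetric] mult_sum_squares_XY_nth coeff)
         (simp add: Suc.IH(1))
  next
    case 2
    have "i - 2 + j < d + 2 * n" if "\<not> i < 2" using 2 that by simp
    moreover have "i + (j - 2) < d + 2 * n" if "\<not> j < 2" using 2 that by simp
    ultimately show ?case
      by (simp only: power_Suc2 mult.assoc[symmetric] mult_sum_squares_XY_nth) (simp add: Suc.IH(2))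
  next
    case 3
    have "degree (P * [:1, 0, 1:] ^ n * [:1, 0, 1:]) \<le> d + 2 * n + 2"
      by (rule order.trans[OF degree_mult_le]) (use Suc.IH(3) in simp)
    thus ?case by (simp only: power_Suc2 mult.assoc[symmetric]) simp
  }
qed (use assms in simp_all)

text \<open>The order of \<open>f\<close> serves as \<open>d\<close>, so one bound covers all
  \<open>e\<close>.\<close>

lemma mult_sum_squares_XY_power_nonzero:
  fixes f :: "'a::field fps fps"
  assumes p: "CHAR('a) > 0" and f: "f \<noteq> 0"
  shows "\<exists>d. \<forall>e h. CHAR('a) ^ e = 2 * h + 1 \<longrightarrow> d < h \<longrightarrow>
           (\<exists>i j. i < 2 * h + 1 \<and> j < 2 * h + 1 \<and> (f * sum_squares_XY ^ (h + 1)) $ j $ i \<noteq> 0)"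
proof -
  define d where "d = (LEAST d. \<exists>i j. i + j = d \<and> f $ j $ i \<noteq> 0)"
  have "\<exists>d i j. i + j = d \<and> f $ j $ i \<noteq> 0"
    using f by (auto simp: fps_eq_iff)
  hence "\<exists>i j. i + j = d \<and> f $ j $ i \<noteq> 0"
    unfolding d_def by (rule LeastI_ex)
  then obtain i0 j0 where ij0: "i0 + j0 = d" "f $ j0 $ i0 \<noteq> 0" by blast
  have low: "f $ j $ i = 0" if "i + j < d" for i j
    using not_less_Least that unfolding d_def by blast
  define P where "P = (\<Sum>i\<le>d. monom (f $ (d - i) $ i) i)"
  have coeffP: "coeff P i = (if i \<le> d then f $ (d - i) $ i else 0)" for i
    by (simp add: P_def coeff_sum)
  have degP: "degree P \<le> d"
    by (rule degree_le) (simp add: coeffP)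
  have "coeff P i0 \<noteq> 0" using ij0 by (auto simp: coeffP)
  hence P0: "P \<noteq> 0" by auto
  have "\<exists>i j. i < 2 * h + 1 \<and> j < 2 * h + 1 \<and> (f * sum_squares_XY ^ (h + 1)) $ j $ i \<noteq> 0"
    if e: "CHAR('a) ^ e = 2 * h + 1" and "d < h" for e h
  proof -
    obtain i where i: "d + 1 < i" "i < 2 * h + 1" "coeff (P * [:1, 0, 1:] ^ (h + 1)) i \<noteq> 0"
      using coeff_mult_sum_squares_power_nonzero[OF p e \<open>d < h\<close> P0 degP] by blast
    \<comment> \<open>The complementary exponent of \<open>Y\<close> in the lowest form;
      \<open>d + 1 < i\<close> puts it below \<open>2 * h + 1\<close>.\<close>
    define j where "j = d + 2 * (h + 1) - i"
    have "i + j = d + 2 * (h + 1)" using i \<open>d < h\<close> by (simp add: j_def)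
    hence "(f * sum_squares_XY ^ (h + 1)) $ j $ i = coeff (P * [:1, 0, 1:] ^ (h + 1)) i"
      by (intro lowest_form_mult_sum_squares_XY_power(1) low) (use degP in \<open>auto simp: coeffP\<close>)
    moreover have "j < 2 * h + 1" using i by (simp add: j_def)
    ultimately show ?thesis using i by metis
  qed
  thus ?thesis by blast
qed

section \<open>Division by the quadric\<close>

definition quadric :: "'a::comm_ring_1 fps fps fps" where
  "quadric = var_X ^ 2 + var_Y ^ 2 + var_Z ^ 2"

lemma quadric_altdef: "quadric = fps_const sum_squares_XY + fps_X ^ 2"
  by (simp add: quadric_def var_X_def var_Y_def var_Z_def sum_squares_XY_def fps_const_power
      flip: fps_const_add)

text \<open>Comparing coefficients of \<open>Z^(k + 2)\<close> in a Weierstrass division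
  \<open>f = g Q + r\<close> gives \<open>g_k = f_(k+2) - (X^2 + Y^2) g_(k+2)\<close>. The recursion
  raises \<open>k\<close> but lowers the exponent of \<open>X\<close> or \<open>Y\<close>, so it
  terminates.\<close>

fun quadric_quotient_coeff :: "(nat \<Rightarrow> nat \<Rightarrow> nat \<Rightarrow> 'a) \<Rightarrow> nat \<Rightarrow> nat \<Rightarrow> nat \<Rightarrow> 'a::comm_ring_1" where
  "quadric_quotient_coeff c i j k = c i j (k + 2)
     - (if i < 2 then 0 else quadric_quotient_coeff c (i - 2) j (k + 2))
     - (if j < 2 then 0 else quadric_quotient_coeff c i (j - 2) (k + 2))"

declare quadric_quotient_coeff.simps [simp del]

lemma quadric_division:
  fixes f :: "'a::comm_ring_1 fps fps fps"
  obtains g a b where "f = g * quadric + (fps_const a + fps_const b * fps_X)"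
proof -
  define c where "c = quadric_quotient_coeff (fps3_nth f)"
  define g where "g = Abs_fps (\<lambda>k. Abs_fps (\<lambda>j. Abs_fps (\<lambda>i. c i j k)))"
  define r where "r = f - g * quadric"
  have "r $ n = 0" if "n \<ge> 2" for n
  proof -
    define k where "k = n - 2"
    have k: "n = k + 2" using that by (simp add: k_def)
    have "r $ n $ j $ i = 0" for i j
      by (simp add: k r_def quadric_altdef distrib_left fps_X_power_mult_right_nth
          mult_sum_squares_XY_nth g_def c_def fps3_nth_def
          quadric_quotient_coeff.simps[of _ i j k])
    thus ?thesis by (simp add: fps_eq_iff)
  qed
  hence "r = fps_const (r $ 0) + fps_const (r $ 1) * fps_X"
    by (intro fps_ext) (auto simp: numeral_2_eq_2 not_less_eq_eq le_Suc_eq)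
  moreover have "f = g * quadric + r" by (simp add: r_def)
  ultimately have "f = g * quadric + (fps_const (r $ 0) + fps_const (r $ 1) * fps_X)"
    by metis
  thus ?thesis by (rule that)
qed

lemma quadric_nonzero: "quadric \<noteq> (0 :: 'a::comm_ring_1 fps fps fps)"
proof
  assume "quadric = (0 :: 'a fps fps fps)"
  hence "quadric $ 2 = (0 :: 'a fps fps)" by simp
  thus False unfolding quadric_altdef by (simp add: fps_X_power_nth)
qed

section \<open>Coefficients of powers of the quadric\<close>

text \<open>By Frobenius \<open>Q^q = Z^(2 q) + (X^2 + Y^2)^q\<close>; dividing by \<open>Q\<close>
  leaves a geometric sum in \<open>Z^2\<close> and \<open>-(X^2 + Y^2)\<close>, free of binomial
  coefficients.\<close>

lemma quadric_power_nth:
  assumes p: "CHAR('a::field) > 0" and q: "CHAR('a) ^ e = 2 * h + 1"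
  shows "(quadric ^ (2 * h) :: 'a fps fps fps) $ n =
    (if even n \<and> n \<le> 4 * h then (- sum_squares_XY) ^ (2 * h - n div 2) else 0)"
proof -
  define q where "q = 2 * h + 1"
  \<comment> \<open>The sign makes \<open>quadric = Z^2 - D\<close>, which fits the formula for a
    difference of powers.\<close>
  define D :: "'a fps fps fps" where "D = - fps_const sum_squares_XY"
  define S where "S = (\<Sum>k<q. (fps_X ^ 2) ^ k * D ^ (q - Suc k))"
  have prime: "Factorial_Ring.prime CHAR('a fps fps fps)"
    using p by (simp add: prime_CHAR_semidom)
  have Q: "quadric = fps_X ^ 2 - D" by (simp add: quadric_altdef D_def)
  have "quadric * S = (fps_X ^ 2) ^ q - D ^ q"
    unfolding S_def Q by (simp only: power_diff_sumr2 mult_ac)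
  also have "\<dots> = quadric ^ q"
  proof -
    have "quadric ^ q = (fps_X ^ 2 + (- D)) ^ q"
      unfolding Q by (simp only: diff_conv_add_uminus)
    also have "\<dots> = (fps_X ^ 2) ^ q + (- D) ^ q"
      by (rule freshmans_dream'[OF prime, where n = e]) (simp add: q q_def)
    also have "(- D) ^ q = - (D ^ q)" by (simp add: q_def)
    finally show ?thesis by simp
  qed
  also have "\<dots> = quadric * quadric ^ (2 * h)" by (simp add: q_def)
  finally have "quadric ^ (2 * h) = S" using quadric_nonzero[where 'a = 'a] by simp
  also have "S $ n = (\<Sum>k<q. if n = 2 * k then (- sum_squares_XY) ^ (q - Suc k) else 0)"
    unfolding S_def fps_sum_nth
  proof (rule sum.cong)
    fix k
    have "D ^ (q - Suc k) = fps_const ((- sum_squares_XY) ^ (q - Suc k))"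
      by (simp add: D_def fps_const_power)
    thus "((fps_X ^ 2) ^ k * D ^ (q - Suc k)) $ n = (if n = 2 * k then (- sum_squares_XY) ^ (q - Suc k) else 0)"
      by (simp add: fps_X_power_nth flip: power_mult)
  qed simp
  also have "\<dots> = (if even n \<and> n \<le> 4 * h then (- sum_squares_XY) ^ (2 * h - n div 2) else 0)"
  proof (cases "even n")
    case True
    hence *: "n = 2 * k \<longleftrightarrow> k = n div 2" for k by auto
    have "n div 2 < q \<longleftrightarrow> n \<le> 4 * h" using True by (auto simp: q_def)
    thus ?thesis using True unfolding * by (auto simp: q_def)
  next
    case False
    thus ?thesis by (auto intro!: sum.neutral)
  qed
  finally show ?thesis .
qed

lemma mult_neg_power_nth_eq_0_iff:
  "(f * (- g) ^ n) $ j $ i = 0 \<longleftrightarrow> (f * g ^ n) $ j $ i = 0" for f g :: "'a::comm_ring_1 fps fps"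
  by (cases "even n") simp_all

lemma mult_quadric_power_nonzero:
  fixes f :: "'a::field fps fps fps"
  assumes p: "CHAR('a) > 0" and odd: "odd CHAR('a)"
    and r: "r = fps_const a + fps_const b * fps_X" "r \<noteq> 0"
  shows "\<exists>N. \<forall>e\<ge>N. \<exists>i j k. i < CHAR('a) ^ e \<and> j < CHAR('a) ^ e \<and> k < CHAR('a) ^ e \<and>
           fps3_nth (r * quadric ^ (CHAR('a) ^ e - 1)) i j k \<noteq> (0 :: 'a)"
proof -
  define c where "c = (if a = 0 then b else a)"
  have "c \<noteq> 0" using r by (auto simp: c_def)
  then obtain d where d: "\<And>e h. CHAR('a) ^ e = 2 * h + 1 \<Longrightarrow> d < h \<Longrightarrow>
      \<exists>i j. i < 2 * h + 1 \<and> j < 2 * h + 1 \<and> (c * sum_squares_XY ^ (h + 1)) $ j $ i \<noteq> 0"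
    using mult_sum_squares_XY_power_nonzero[OF p] by blast
  \<comment> \<open>The bound on \<open>e\<close> gives \<open>d < h\<close>, because
    \<open>2 * h + 1 = p^e > e \<ge> 2 * d + 2\<close>.\<close>
  have "\<exists>i j k. i < CHAR('a) ^ e \<and> j < CHAR('a) ^ e \<and> k < CHAR('a) ^ e \<and>
           fps3_nth (r * quadric ^ (CHAR('a) ^ e - 1)) i j k \<noteq> (0 :: 'a)" if e: "e \<ge> 2 * d + 2" for e
  proof -
    obtain h where h: "CHAR('a) ^ e = 2 * h + 1"
      using odd by (metis even_power oddE)
    have "CHAR('a) > 1"
      using p CHAR_not_1[where 'a = 'a] by linarith
    hence "e < CHAR('a) ^ e" by (simp add: power_gt_expt)
    hence "d < h" using e h by linarith
    then obtain i j where ij: "i < 2 * h + 1" "j < 2 * h + 1"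
      "(c * sum_squares_XY ^ (h + 1)) $ j $ i \<noteq> 0"
      using d[OF h] by blast
    have r_nth: "(r * quadric ^ (2 * h)) $ n =
        a * (quadric ^ (2 * h)) $ n + (if n = 0 then 0 else b * (quadric ^ (2 * h)) $ (n - 1))" for n
      by (simp add: r distrib_right mult.assoc fps_X_mult_nth)
    show ?thesis
    proof (cases "a = 0")
      case True
      have "(r * quadric ^ (2 * h)) $ (2 * h - 1) = b * (- sum_squares_XY) ^ (h + 1)"
        using \<open>d < h\<close> True unfolding r_nth quadric_power_nth[OF p h]
        by (cases h) auto
      hence "fps3_nth (r * quadric ^ (2 * h)) i j (2 * h - 1) \<noteq> 0"
        using ij True by (simp only: fps3_nth_def c_def mult_neg_power_nth_eq_0_iff) simp
      thus ?thesis using ij h by (intro exI[of _ i] exI[of _ j] exI[of _ "2 * h - 1"]) simp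
    next
      case False
      \<comment> \<open>The coefficient of \<open>Z^(2 h)\<close> carries only the
        \<open>h\<close>-th power, one less than in the choice of \<open>i\<close> and
        \<open>j\<close>.\<close>
      have "(a * sum_squares_XY ^ h * sum_squares_XY) $ j $ i \<noteq> 0"
        using ij False by (simp add: c_def mult_ac)
      then obtain i' j' where ij': "i' \<le> i" "j' \<le> j" "(a * sum_squares_XY ^ h) $ j' $ i' \<noteq> 0"
        by (rule mult_sum_squares_XY_nth_nonzero)
      have "(r * quadric ^ (2 * h)) $ (2 * h) = a * (- sum_squares_XY) ^ h"
        using \<open>d < h\<close> unfolding r_nth quadric_power_nth[OF p h] by auto
      hence "fps3_nth (r * quadric ^ (2 * h)) i' j' (2 * h) \<noteq> 0"
        using ij' by (simp add: fps3_nth_def mult_neg_power_nth_eq_0_iff)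
      thus ?thesis using ij ij' h by (intro exI[of _ i'] exI[of _ j'] exI[of _ "2 * h"]) simp
    qed
  qed
  thus ?thesis by blast
qed

text \<open>Glassbrenner's construction: composing \<open>T\<close> with multiplication by
  \<open>Q^(q - 1)\<close> gives a map preserving \<open>(Q)\<close>, because
  \<open>T (x Q^q) = T x * Q\<close>. Its value at \<open>f\<close> modulo \<open>Q\<close> is
  determined by the remainder \<open>r\<close>.\<close>

lemma quadric_strongly_F_regular:
  fixes f :: "'a::field fps fps fps"
  assumes p: "CHAR('a) > 0" and odd: "odd CHAR('a)" and f: "\<not> quadric dvd f"
  shows "\<exists>N. \<forall>e\<ge>N. \<exists>T. frobenius_linear (CHAR('a) ^ e) T \<and>
           (\<forall>g. quadric dvd g \<longrightarrow> quadric dvd T g) \<and> quadric dvd T f - 1"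
proof -
  obtain g a b where fg: "f = g * quadric + (fps_const a + fps_const b * fps_X)"
    by (rule quadric_division)
  define r where "r = fps_const a + fps_const b * fps_X"
  have "r \<noteq> 0" using f fg by (auto simp: r_def)
  from mult_quadric_power_nonzero[OF p odd r_def this] obtain N where N:
    "\<And>e. e \<ge> N \<Longrightarrow> \<exists>i j k. i < CHAR('a) ^ e \<and> j < CHAR('a) ^ e \<and> k < CHAR('a) ^ e \<and>
           fps3_nth (r * quadric ^ (CHAR('a) ^ e - 1)) i j k \<noteq> (0 :: 'a)" by blast
  have "\<exists>T. frobenius_linear (CHAR('a) ^ e) T \<and>
           (\<forall>g. quadric dvd g \<longrightarrow> quadric dvd T g) \<and> quadric dvd T f - 1" if e: "e \<ge> N" for e
  proof -
    define q where "q = CHAR('a) ^ e"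
    have "q > 0" using p by (simp add: q_def)
    hence power_q: "quadric * quadric ^ (q - 1) = (quadric ^ q :: 'a fps fps fps)"
      by (simp flip: power_Suc)
    obtain T where T: "frobenius_linear q T" "T (r * quadric ^ (q - 1)) = 1"
      using N[OF e] frobenius_linear_fps3[OF p] unfolding q_def by blast
    define U where "U x = T (x * quadric ^ (q - 1))" for x
    have U: "frobenius_linear q U"
      using frobenius_linear_mult_power[OF T(1), of "x * quadric ^ (q - 1)" for x]
      by (simp add: frobenius_linear_def U_def distrib_right frobenius_linear_add[OF T(1)] mult_ac)
    have UQ: "U (x * quadric) = T x * quadric" for x
      using frobenius_linear_mult_power[OF T(1), of x quadric]
      by (simp add: U_def mult.assoc power_q del: One_nat_def)
    hence "\<forall>g. quadric dvd g \<longrightarrow> quadric dvd U g"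
      by (metis dvd_def dvd_triv_right mult.commute)
    moreover have "U f - 1 = T g * quadric"
      using frobenius_linear_add[OF U, of "g * quadric" r] T(2) UQ[of g]
      by (simp add: fg r_def U_def)
    ultimately show ?thesis using U unfolding q_def by auto
  qed
  thus ?thesis by blast
qed


section \<open>Power series over a Noetherian ring\<close>

text \<open>For a ring acting on itself, \<open>subspace\<close> means ideal and \<open>span\<close>
  means generated ideal.\<close>

interpretation mult_module: Modules.module "(*) :: 'b::comm_ring_1 \<Rightarrow> 'b \<Rightarrow> 'b"
  by unfold_locales (simp_all add: algebra_simps)

text \<open>Read in the ring itself, this rule undoes \<open>mult.assoc\<close>.\<close>

declare mult_module.scale_scale [simp del]

definition noetherian_type :: "'b::comm_ring_1 itself \<Rightarrow> bool" where
  "noetherian_type _ \<longleftrightarrow>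
     (\<forall>I :: 'b set. mult_module.subspace I \<longrightarrow> (\<exists>B. finite B \<and> mult_module.span B = I))"

lemma noetherian_type_field: "noetherian_type TYPE('a::field)"
  unfolding noetherian_type_def
proof (intro allI impI)
  fix I :: "'a set" assume I: "mult_module.subspace I"
  show "\<exists>B. finite B \<and> mult_module.span B = I"
  proof (cases "I = {0}")
    case True
    thus ?thesis by (intro exI[of _ "{}"]) simp
  next
    case False
    then obtain x where x: "x \<in> I" "x \<noteq> 0"
      using mult_module.subspace_0[OF I] by blast
    have "y \<in> mult_module.span {x}" for y
      using mult_module.span_scale[OF mult_module.span_base, of x "{x}" "y / x"] x by simp
    hence "mult_module.span {x} = UNIV" by blast
    moreover have "mult_module.span {x} \<subseteq> I"
      using I x by (intro mult_module.span_minimal) auto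
    ultimately show ?thesis by (intro exI[of _ "{x}"]) auto
  qed
qed

text \<open>Hilbert's basis argument with lowest instead of leading terms. The ideals
  \<open>L n\<close> of \<open>n\<close>-th coefficients of elements of order at least
  \<open>n\<close> increase, as multiplication by \<open>X\<close> shows, and stop at some
  \<open>N\<close>; lifts of generators of \<open>L n\<close> for \<open>n \<le> N\<close> generate
  \<open>I\<close>.\<close>

lemma noetherian_type_fps:
  assumes noeth: "noetherian_type TYPE('b::comm_ring_1)"
  shows "noetherian_type TYPE('b fps)"
  unfolding noetherian_type_def
proof (intro allI impI)
  fix I :: "'b fps set" assume I: "mult_module.subspace I"
  define I' where "I' n = {f \<in> I. \<forall>i<n. f $ i = 0}" for n
  define L where "L n = (\<lambda>f. f $ n) ` I' n" for n
  have I': "mult_module.subspace (I' n)" for n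
    using I by (auto simp: I'_def mult_module.subspace_def fps_mult_nth)
  have L: "mult_module.subspace (L n)" for n
  proof (rule mult_module.subspaceI)
    show "0 \<in> L n"
      unfolding L_def by (rule image_eqI[OF _ mult_module.subspace_0[OF I']]) simp
    show "x + y \<in> L n" if "x \<in> L n" "y \<in> L n" for x y
      using that unfolding L_def by (auto intro!: image_eqI[OF _ mult_module.subspace_add[OF I']])
    show "c * x \<in> L n" if x: "x \<in> L n" for c x
    proof -
      obtain f where f: "f \<in> I' n" "x = f $ n" using x by (auto simp: L_def)
      have "fps_const c * f \<in> I' n" using mult_module.subspace_scale[OF I' f(1)] .
      thus ?thesis unfolding L_def by (rule image_eqI[rotated]) (simp add: f)
    qed
  qed
  have "L n \<subseteq> L (Suc n)" for n
  proof
    fix x assume "x \<in> L n"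
    then obtain f where f: "f \<in> I' n" "x = f $ n" by (auto simp: L_def)
    have "fps_X * f \<in> I' (Suc n)"
      using f mult_module.subspace_scale[OF I] by (auto simp: I'_def fps_X_mult_nth)
    thus "x \<in> L (Suc n)" unfolding L_def by (rule image_eqI[rotated]) (simp add: f)
  qed
  hence L_mono: "L m \<subseteq> L n" if "m \<le> n" for m n
    using that by (rule lift_Suc_mono_le)
  have "\<exists>N. \<forall>n. L n \<subseteq> L N"
  proof -
    \<comment> \<open>The union of the chain is an ideal, and finitely many generators of it lie in
      a single \<open>L N\<close>.\<close>
    have "mult_module.subspace (\<Union>n. L n)"
    proof (rule mult_module.subspaceI)
      show "0 \<in> (\<Union>n. L n)" using mult_module.subspace_0[OF L] by blast
      show "x + y \<in> (\<Union>n. L n)" if xy: "x \<in> (\<Union>n. L n)" "y \<in> (\<Union>n. L n)" for x y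
      proof -
        obtain m n where "x \<in> L m" "y \<in> L n" using xy by blast
        hence "x \<in> L (max m n)" "y \<in> L (max m n)"
          using L_mono[of m "max m n"] L_mono[of n "max m n"] by auto
        thus ?thesis using mult_module.subspace_add[OF L] by blast
      qed
      show "c * x \<in> (\<Union>n. L n)" if "x \<in> (\<Union>n. L n)" for c x
        using that mult_module.subspace_scale[OF L] by blast
    qed
    then obtain B where B: "finite B" "mult_module.span B = (\<Union>n. L n)"
      using noeth unfolding noetherian_type_def by blast
    hence "\<forall>b\<in>B. \<exists>n. b \<in> L n" using mult_module.span_superset by blast
    then obtain k where k: "\<And>b. b \<in> B \<Longrightarrow> b \<in> L (k b)" by metis
    have "b \<in> L (Max (insert 0 (k ` B)))" if "b \<in> B" for b
      using k[OF that] L_mono[of "k b" "Max (insert 0 (k ` B))"] B(1) that by auto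
    hence "mult_module.span B \<subseteq> L (Max (insert 0 (k ` B)))"
      by (intro mult_module.span_minimal L) auto
    thus ?thesis using B by blast
  qed
  then obtain N where N: "\<And>n. L n \<subseteq> L N" by blast
  have "\<exists>G. finite G \<and> G \<subseteq> I' n \<and> (\<forall>x\<in>L n. \<exists>c. x = (\<Sum>g\<in>G. c g * g $ n))" for n
  proof -
    obtain B where B: "finite B" "mult_module.span B = L n"
      using noeth L unfolding noetherian_type_def by blast
    hence "B \<subseteq> (\<lambda>f. f $ n) ` I' n"
      using mult_module.span_superset unfolding L_def by blast
    then obtain G where G: "G \<subseteq> I' n" "inj_on (\<lambda>f. f $ n) G" "B = (\<lambda>f. f $ n) ` G"
      by (auto simp: subset_image_inj)
    have "\<exists>c. x = (\<Sum>g\<in>G. c g * g $ n)" if x: "x \<in> L n" for x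
    proof -
      obtain u where "x = (\<Sum>v\<in>B. u v * v)"
        using x B mult_module.span_finite[OF B(1)] by auto
      thus ?thesis using G by (intro exI[of _ "\<lambda>g. u (g $ n)"]) (simp add: sum.reindex)
    qed
    moreover have "finite G" using B(1) G finite_image_iff by blast
    ultimately show ?thesis using G by blast
  qed
  then obtain G where G: "\<And>n. finite (G n)" "\<And>n. G n \<subseteq> I' n"
      "\<And>n x. x \<in> L n \<Longrightarrow> \<exists>c. x = (\<Sum>g\<in>G n. c g * g $ n)"
    by metis
  define H where "H = (\<Union>n\<le>N. G n)"
  have "finite H" using G(1) by (simp add: H_def)
  have HI: "H \<subseteq> I" using G(2) by (auto simp: H_def I'_def)
  have G_span: "(\<Sum>g\<in>G n. c g * g) \<in> mult_module.span H" if "n \<le> N" for n c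
    using that unfolding H_def
    by (intro mult_module.span_sum mult_module.span_scale mult_module.span_base) blast
  have low: "\<exists>s\<in>mult_module.span H. f - s \<in> I' n" if "f \<in> I" "n \<le> N" for f n
    using that(2)
  proof (induction n)
    case 0
    thus ?case using that(1) by (intro bexI[of _ 0]) (auto simp: I'_def mult_module.span_zero)
  next
    case (Suc n)
    then obtain s where s: "s \<in> mult_module.span H" "f - s \<in> I' n" by auto
    have "(f - s) $ n \<in> L n" unfolding L_def using s(2) by (rule imageI)
    then obtain c where c: "(f - s) $ n = (\<Sum>g\<in>G n. c g * g $ n)"
      using G(3) by blast
    define t where "t = (\<Sum>g\<in>G n. fps_const (c g) * g)"
    have t: "t \<in> I' n"
      unfolding t_def using G(2)
      by (auto intro!: mult_module.subspace_sum mult_module.subspace_scale I')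
    have "(f - s - t) $ n = 0" using c by (simp add: t_def fps_sum_nth)
    moreover have "f - s - t \<in> I' n"
      using mult_module.subspace_diff[OF I' s(2) t] .
    ultimately have "f - (s + t) \<in> I' (Suc n)"
      by (auto simp: I'_def less_Suc_eq diff_diff_eq)
    moreover have "s + t \<in> mult_module.span H"
      using s(1) G_span[of n "\<lambda>g. fps_const (c g)"] Suc.prems
      unfolding t_def by (intro mult_module.span_add) auto
    ultimately show ?case by blast
  qed
  have high: "f \<in> mult_module.span H" if f: "f \<in> I' N" for f
  proof -
    \<comment> \<open>Beyond level \<open>N\<close>, the generators of level \<open>N\<close>
      shifted by \<open>X^k\<close> suffice, as \<open>L (N + k) \<subseteq> L N\<close>.\<close>
    have "\<exists>c. f \<in> I' (N + k) \<longrightarrow> f $ (N + k) = (\<Sum>g\<in>G N. c g * g $ N)" for f k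
      using G(3)[of "f $ (N + k)" N] N[of "N + k"] unfolding L_def by blast
    then obtain C where C: "\<And>f k. f \<in> I' (N + k) \<Longrightarrow> f $ (N + k) = (\<Sum>g\<in>G N. C f k g * g $ N)"
      by metis
    define F where "F = rec_nat f (\<lambda>k r. r - fps_X ^ k * (\<Sum>g\<in>G N. fps_const (C r k g) * g))"
    have F0: "F 0 = f" and FSuc: "F (Suc k) = F k - fps_X ^ k * (\<Sum>g\<in>G N. fps_const (C (F k) k g) * g)" for k
      by (simp_all add: F_def)
    have F: "F k \<in> I' (N + k)" for k
    proof (induction k)
      case (Suc k)
      define t where "t = (\<Sum>g\<in>G N. fps_const (C (F k) k g) * g)"
      have t: "t \<in> I' N"
        unfolding t_def using G(2)
        by (auto intro!: mult_module.subspace_sum mult_module.subspace_scale I')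
      have "fps_X ^ k * t \<in> I' (N + k)"
        using t mult_module.subspace_scale[OF I] by (auto simp: I'_def fps_X_power_mult_nth)
      hence "F (Suc k) \<in> I' (N + k)"
        unfolding FSuc t_def[symmetric] by (rule mult_module.subspace_diff[OF I' Suc])
      moreover have "F (Suc k) $ (N + k) = 0"
        using C[OF Suc] unfolding FSuc by (simp add: fps_X_power_mult_nth fps_sum_nth)
      ultimately show ?case by (auto simp: I'_def less_Suc_eq)
    qed (simp add: F0 f)
    define h where "h g = Abs_fps (\<lambda>k. C (F k) k g)" for g
    \<comment> \<open>The last sum is the part of the series \<open>h g\<close> not yet subtracted
      after \<open>k\<close> steps. At \<open>k = n + 1\<close> both it, with its factor
      \<open>X^k\<close>, and \<open>F k\<close> vanish in degree \<open>n\<close>.\<close>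
    have F_eq: "F k = f - (\<Sum>g\<in>G N. h g * g) + fps_X ^ k * (\<Sum>g\<in>G N. fps_shift k (h g) * g)" for k
    proof (induction k)
      case (Suc k)
      have "fps_shift k (h g) = fps_const (C (F k) k g) + fps_X * fps_shift (Suc k) (h g)" for g
        by (rule fps_ext) (simp add: h_def fps_X_mult_nth)
      hence shift: "(\<Sum>g\<in>G N. fps_shift k (h g) * g) =
          (\<Sum>g\<in>G N. fps_const (C (F k) k g) * g) + fps_X * (\<Sum>g\<in>G N. fps_shift (Suc k) (h g) * g)"
        by (simp only: distrib_right sum.distrib sum_distrib_left mult.assoc)
      have step: "A - x ^ k * s = u + x ^ Suc k * b"
        if "a = s + x * b" "A = u + x ^ k * a" for A a s b u x :: "'b fps"
        unfolding that power_Suc2 distrib_left mult.assoc by simp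
      show ?case unfolding FSuc by (rule step[OF shift Suc.IH])
    qed (simp add: F0)
    have "f $ n = (\<Sum>g\<in>G N. h g * g) $ n" for n
    proof -
      have "F (Suc n) $ n = 0" using F[of "Suc n"] by (simp add: I'_def)
      thus ?thesis by (subst (asm) F_eq) (simp add: fps_X_power_mult_nth del: power_Suc)
    qed
    hence "(\<Sum>g\<in>G N. h g * g) = f" by (intro fps_ext) simp
    thus ?thesis using G_span[OF order_refl, of h] by simp
  qed
  have "I \<subseteq> mult_module.span H"
  proof
    fix f assume "f \<in> I"
    then obtain s where s: "s \<in> mult_module.span H" "f - s \<in> I' N" using low by blast
    thus "f \<in> mult_module.span H"
      using mult_module.span_add[OF high[OF s(2)] s(1)] by simp
  qed
  hence "mult_module.span H = I"
    using mult_module.span_minimal[OF HI I] by blast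
  thus "\<exists>B. finite B \<and> mult_module.span B = I"
    using \<open>finite H\<close> by blast
qed


section \<open>Tight closure in strongly F-regular rings\<close>

text \<open>Bridge from a type-class ring to a ring with carrier: calculations use representatives,
  and ideals are moved by preimage and image.\<close>

locale surjective_ring_hom = cring R for R :: "('c, 'm) ring_scheme" (structure) +
  fixes \<pi> :: "'b::comm_ring_1 \<Rightarrow> 'c"
  assumes range: "range \<pi> = carrier R"
    and hom_add: "\<pi> (x + y) = \<pi> x \<oplus> \<pi> y"
    and hom_mult: "\<pi> (x * y) = \<pi> x \<otimes> \<pi> y"
    and hom_one: "\<pi> 1 = \<one>"
begin

lemma hom_closed [simp]: "\<pi> x \<in> carrier R"
  using range by blast

lemma hom_zero: "\<pi> 0 = \<zero>"
  using hom_add[of 0 0] add.l_cancel_one[of "\<pi> 0" "\<pi> 0"] by simp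

lemma hom_minus: "\<pi> (- x) = \<ominus> \<pi> x"
  by (rule minus_equality[symmetric]) (simp_all add: hom_zero flip: hom_add)

lemma hom_diff: "\<pi> (x - y) = \<pi> x \<ominus> \<pi> y"
  using hom_add[of x "- y"] by (simp add: hom_minus a_minus_def)

lemma hom_power: "\<pi> (x ^ n) = \<pi> x [^] n"
  by (induction n) (simp_all add: hom_one hom_mult m_comm)

lemma hom_of_nat: "\<pi> (of_nat n) = [n] \<cdot> \<one>"
  by (induction n) (simp_all add: hom_zero hom_one hom_add a_comm)

lemma surj: "x \<in> carrier R \<Longrightarrow> \<exists>y. x = \<pi> y"
  using range by blast

lemma subspace_vimage:
  assumes "ideal I R"
  shows "mult_module.subspace (\<pi> -` I)"
proof -
  interpret I: ideal I R by fact
  show ?thesis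
    by (auto simp: mult_module.subspace_def hom_zero hom_add hom_mult intro: I.I_l_closed)
qed

lemma ideal_image:
  assumes V: "mult_module.subspace V"
  shows "ideal (\<pi> ` V) R"
proof (rule idealI[OF ring_axioms])
  show "subgroup (\<pi> ` V) (add_monoid R)"
  proof (rule add.subgroupI)
    show "\<pi> ` V \<noteq> {}" using mult_module.subspace_0[OF V] by blast
    show "\<ominus> a \<in> \<pi> ` V" if "a \<in> \<pi> ` V" for a
      using that mult_module.subspace_neg[OF V] by (auto simp flip: hom_minus)
    show "a \<oplus> b \<in> \<pi> ` V" if "a \<in> \<pi> ` V" "b \<in> \<pi> ` V" for a b
      using that mult_module.subspace_add[OF V] by (auto simp flip: hom_add)
  qed auto
next
  fix a x assume "a \<in> \<pi> ` V" "x \<in> carrier R"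
  then obtain v y where "v \<in> V" "a = \<pi> v" "x = \<pi> y" using surj by blast
  thus "x \<otimes> a \<in> \<pi> ` V" using mult_module.subspace_scale[OF V] by (auto simp flip: hom_mult)
  thus "a \<otimes> x \<in> \<pi> ` V"
    using \<open>a = \<pi> v\<close> \<open>x \<in> carrier R\<close> by (simp add: m_comm)
qed

lemma noetherian_ring_image:
  assumes "noetherian_type TYPE('b)"
  shows "noetherian_ring R"
proof (rule noetherian_ring.intro[OF ring_axioms], unfold_locales)
  fix I assume I: "ideal I R"
  obtain B where B: "finite B" "mult_module.span B = \<pi> -` I"
    using assms subspace_vimage[OF I] unfolding noetherian_type_def by blast
  have BI: "\<pi> ` B \<subseteq> I" using B(2) mult_module.span_superset by blast
  have carrier: "\<pi> ` B \<subseteq> carrier R" by auto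
  have "B \<subseteq> \<pi> -` (Idl (\<pi> ` B))" using genideal_self[OF carrier] by blast
  hence "mult_module.span B \<subseteq> \<pi> -` (Idl (\<pi> ` B))"
    by (intro mult_module.span_minimal subspace_vimage genideal_ideal[OF carrier])
  moreover have "I \<subseteq> \<pi> ` (\<pi> -` I)"
    using ideal.Icarr[OF I] surj by blast
  ultimately have "I \<subseteq> Idl (\<pi> ` B)" using B(2) by blast
  hence "I = Idl (\<pi> ` B)" using genideal_minimal[OF I BI] by blast
  thus "\<exists>A\<subseteq>carrier R. finite A \<and> I = Idl A"
    using B(1) carrier by blast
qed

text \<open>An element of \<open>R\<close> with a representative outside \<open>M\<close> is a unit,
  so every proper ideal lies in the image of \<open>M\<close>.\<close>

lemma local_ring_image:
  assumes M: "mult_module.subspace M" and unit: "\<And>x. x \<notin> M \<Longrightarrow> x dvd 1"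
    and proper: "\<one> \<notin> \<pi> ` M"
  shows "local_ring R"
proof -
  have maximal: "I \<subseteq> \<pi> ` M" if I: "ideal I R" "I \<noteq> carrier R" for I
  proof
    fix x assume x: "x \<in> I"
    then obtain y where y: "x = \<pi> y" using ideal.Icarr[OF I(1)] surj by blast
    have "y \<in> M"
    proof (rule ccontr)
      assume "y \<notin> M"
      then obtain z where "1 = y * z" using unit by blast
      hence "\<one> = x \<otimes> \<pi> z" by (metis hom_one hom_mult y)
      hence "\<one> \<in> I" using ideal.I_r_closed[OF I(1) x, of "\<pi> z"] by simp
      thus False using I ideal.one_imp_carrier by blast
    qed
    thus "x \<in> \<pi> ` M" using y by blast
  qed
  have MR: "\<pi> ` M \<noteq> carrier R" using proper by blast
  have "maximalideal (\<pi> ` M) R"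
  proof (rule maximalidealI[OF ideal_image[OF M]])
    show "carrier R \<noteq> \<pi> ` M" using MR by blast
    show "J = \<pi> ` M \<or> J = carrier R" if "ideal J R" "\<pi> ` M \<subseteq> J" for J
      using maximal that by blast
  qed
  moreover have "J = \<pi> ` M" if "maximalideal J R" for J
  proof -
    interpret J: maximalideal J R by fact
    have "J \<subseteq> \<pi> ` M" using maximal[OF J.ideal_axioms] J.I_notcarr by blast
    moreover have "\<pi> ` M \<subseteq> carrier R" by auto
    ultimately show ?thesis
      using J.I_maximal[OF ideal_image[OF M]] MR by blast
  qed
  ultimately show ?thesis unfolding local_ring_def using is_cring by blast
qed

end

text \<open>
  The map \<open>T\<close> of \<open>splitting\<close> induces on \<open>R\<close> a \<open>p\<^sup>-\<^sup>e\<close>-linear map sending the image of \<open>c\<close> to \<open>1\<close>, as in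
  the definition of strong F-regularity; but \<open>R\<close> need not be F-finite here.
\<close>

locale strongly_F_regular_image = surjective_ring_hom +
  fixes p :: nat
  assumes p_pos: "p > 0" and one_neq_zero: "\<one> \<noteq> \<zero>"
    and splitting: "\<pi> c \<noteq> \<zero> \<Longrightarrow> \<exists>N. \<forall>e\<ge>N. \<exists>T. frobenius_linear (p ^ e) T \<and>
      (\<forall>x. \<pi> x = \<zero> \<longrightarrow> \<pi> (T x) = \<zero>) \<and> \<pi> (T c) = \<one>"
begin

text \<open>If \<open>a b = 0\<close>, then \<open>x y^q\<close> represents 0, hence so does
  \<open>T (x y^q) = T x * y\<close>; choosing \<open>T x\<close> to represent 1 gives
  \<open>b = 0\<close>.\<close>

lemma is_domain: "domain R"
proof (rule domainI[OF is_cring one_neq_zero])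
  fix a b assume ab: "a \<otimes> b = \<zero>" "a \<in> carrier R" "b \<in> carrier R"
  then obtain x y where xy: "a = \<pi> x" "b = \<pi> y" using surj by blast
  show "a = \<zero> \<or> b = \<zero>"
  proof (rule disj_imp[THEN iffD2], rule impI)
    assume "a \<noteq> \<zero>"
    then obtain e T where T: "frobenius_linear (p ^ e) T"
      "\<And>z. \<pi> z = \<zero> \<Longrightarrow> \<pi> (T z) = \<zero>" "\<pi> (T x) = \<one>"
      using splitting[of x] xy by blast
    have "p ^ e > 0" using p_pos by simp
    then obtain m where m: "p ^ e = Suc m" using gr0_implies_Suc by blast
    have "\<pi> (x * y ^ (p ^ e)) = a \<otimes> b \<otimes> \<pi> (y ^ m)"
      unfolding m by (simp add: hom_mult xy m_assoc)
    hence "\<pi> (T (x * y ^ (p ^ e))) = \<zero>" using ab by (intro T(2)) simp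
    thus "b = \<zero>"
      using T(3) xy by (simp add: frobenius_linear_mult_power[OF T(1)] hom_mult)
  qed
qed

text \<open>Ensures that the multiplier \<open>c\<close> in a tight closure relation is nonzero, as
  \<open>splitting\<close> requires.\<close>

lemma minimal_prime_zero: "minimal_prime R {\<zero>}"
proof -
  interpret domain R by (rule is_domain)
  have "Q = {\<zero>}" if "primeideal Q R" "Q \<subseteq> {\<zero>}" for Q
  proof -
    interpret Q: primeideal Q R by fact
    show ?thesis using Q.zero_closed that by blast
  qed
  thus ?thesis using zeroprimeideal by (simp add: minimal_prime_def)
qed

lemma ideal_subset_tight_closure:
  assumes I: "ideal I R"
  shows "I \<subseteq> tight_closure R p I"
proof
  fix x assume x: "x \<in> I"
  interpret I: ideal I R by fact
  have xR: "x \<in> carrier R" using x by (rule I.Icarr)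
  have "(\<lambda>x. x [^] q) ` I \<subseteq> carrier R" for q :: nat by auto
  hence "x [^] q \<in> frobenius_power R q I" for q :: nat
    unfolding frobenius_power_def using x genideal_self by blast
  hence "\<one> \<otimes> x [^] (p ^ e) \<in> frobenius_power R (p ^ e) I" for e
    using xR by simp
  moreover have "\<one> \<notin> P" if "minimal_prime R P" for P
  proof -
    interpret P: primeideal P R using that by (simp add: minimal_prime_def)
    show ?thesis using P.I_notcarr P.one_imp_carrier by blast
  qed
  ultimately show "x \<in> tight_closure R p I"
    unfolding tight_closure_def using xR one_closed by blast
qed

lemma tight_closure_subset_ideal:
  assumes I: "ideal I R"
  shows "tight_closure R p I \<subseteq> I"
proof
  fix x assume "x \<in> tight_closure R p I"
  then obtain c N where x: "x \<in> carrier R" and c: "c \<in> carrier R"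
    and cP: "\<And>P. minimal_prime R P \<Longrightarrow> c \<notin> P"
    and N: "\<And>e. e \<ge> N \<Longrightarrow> c \<otimes> x [^] (p ^ e) \<in> frobenius_power R (p ^ e) I"
    unfolding tight_closure_def by blast
  interpret I: ideal I R by fact
  obtain x' c' where x': "x = \<pi> x'" and c': "c = \<pi> c'" using x c surj by blast
  have "\<pi> c' \<noteq> \<zero>" using cP[OF minimal_prime_zero] c' by simp
  then obtain N' where N': "\<And>e. e \<ge> N' \<Longrightarrow> \<exists>T. frobenius_linear (p ^ e) T \<and>
      (\<forall>x. \<pi> x = \<zero> \<longrightarrow> \<pi> (T x) = \<zero>) \<and> \<pi> (T c') = \<one>"
    using splitting by blast
  define q where "q = p ^ max N N'"
  obtain T where T: "frobenius_linear q T" "\<And>z. \<pi> z = \<zero> \<Longrightarrow> \<pi> (T z) = \<zero>" "\<pi> (T c') = \<one>"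
    using N'[of "max N N'"] unfolding q_def by auto
  \<comment> \<open>Quantifying over \<open>h\<close> makes \<open>V\<close> an ideal, and
    \<open>T (h * y^q) = T h * y\<close> puts the \<open>q\<close>-th powers of representatives of
    \<open>I\<close> into it; so the Frobenius power of \<open>I\<close> lies in the image of
    \<open>V\<close>.\<close>
  define V where "V = {v. \<forall>h. \<pi> (T (h * v)) \<in> I}"
  have V: "mult_module.subspace V"
  proof (rule mult_module.subspaceI)
    show "0 \<in> V"
      by (simp add: V_def frobenius_linear_zero[OF T(1)] hom_zero)
    show "u + v \<in> V" if "u \<in> V" "v \<in> V" for u v
      using that by (simp add: V_def distrib_left frobenius_linear_add[OF T(1)] hom_add)
    show "r * v \<in> V" if "v \<in> V" for r v
      using that by (simp add: V_def flip: mult.assoc)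
  qed
  have "(\<lambda>x. x [^] q) ` I \<subseteq> \<pi> ` V"
  proof (rule image_subsetI)
    fix y assume y: "y \<in> I"
    then obtain y' where y': "y = \<pi> y'" using I.Icarr surj by blast
    have "y' ^ q \<in> V"
      using y by (auto simp: V_def frobenius_linear_mult_power[OF T(1)] hom_mult y' intro: I.I_l_closed)
    thus "y [^] q \<in> \<pi> ` V" by (auto simp: y' simp flip: hom_power)
  qed
  hence "frobenius_power R q I \<subseteq> \<pi> ` V"
    unfolding frobenius_power_def by (intro genideal_minimal ideal_image V)
  hence "\<pi> (c' * x' ^ q) \<in> \<pi> ` V"
    using N[of "max N N'"] by (auto simp: q_def x' c' hom_mult hom_power)
  then obtain v where v: "v \<in> V" "\<pi> (c' * x' ^ q) = \<pi> v" by blast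
  \<comment> \<open>The representative of \<open>c x^q\<close> is in \<open>V\<close> only up to the
    kernel, which \<open>T\<close> preserves.\<close>
  have "\<pi> (c' * x' ^ q - v) = \<zero>"
    using v(2) by (simp add: hom_diff)
  hence "\<pi> (T (c' * x' ^ q - v)) = \<zero>" by (rule T(2))
  hence "\<pi> (T (c' * x' ^ q)) = \<pi> (T v)"
    using frobenius_linear_add[OF T(1), of "c' * x' ^ q - v" v] by (simp add: hom_add)
  moreover have "\<pi> (T v) \<in> I"
    using v(1) unfolding V_def by (auto dest: spec[of _ 1])
  moreover have "\<pi> (T (c' * x' ^ q)) = x"
    by (simp add: frobenius_linear_mult_power[OF T(1)] hom_mult T(3) x')
  ultimately show "x \<in> I" by simp
qed

lemma tight_closure_ideal: "ideal I R \<Longrightarrow> tight_closure R p I = I"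
  using tight_closure_subset_ideal ideal_subset_tight_closure by blast

end


section \<open>F-rationality of the quadric\<close>

lemma quadric_ring_surjective_ring_hom:
  fixes J :: "'a::field fps fps fps set"
  defines "J \<equiv> Idl\<^bsub>ring_of_type_algebra\<^esub> {quadric}"
  shows "surjective_ring_hom quadric_ring (a_r_coset ring_of_type_algebra J)"
    and "a_r_coset ring_of_type_algebra J x = \<zero>\<^bsub>quadric_ring\<^esub> \<longleftrightarrow> quadric dvd x"
proof -
  define S where "S = (ring_of_type_algebra :: 'a fps fps fps ring)"
  have S_simps: "carrier S = UNIV" "x \<oplus>\<^bsub>S\<^esub> y = x + y" "x \<otimes>\<^bsub>S\<^esub> y = x * y" "\<one>\<^bsub>S\<^esub> = 1" for x y
    by (simp_all add: S_def ring_of_type_algebra_def)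
  interpret S: cring S unfolding S_def by (rule cring_from_type_algebra)
  have J: "J = Idl\<^bsub>S\<^esub> {quadric}" by (simp add: J_def S_def)
  interpret J: ideal J S unfolding J by (rule S.genideal_ideal) (simp add: S_simps)
  have J_iff: "x \<in> J \<longleftrightarrow> quadric dvd x" for x
    unfolding J using S.cgenideal_eq_genideal[of quadric]
    by (auto simp: cgenideal_def S_simps dvd_def mult.commute)
  have R: "quadric_ring = S Quot J"
    by (simp add: quadric_ring_def Let_def J quadric_def S_def)
  show "surjective_ring_hom quadric_ring (a_r_coset ring_of_type_algebra J)"
    unfolding R S_def[symmetric]
  proof (rule surjective_ring_hom.intro)
    show "cring (S Quot J)" by (rule J.quotient_is_cring[OF S.is_cring])
    interpret hom: ring_hom_ring S "S Quot J" "(+>\<^bsub>S\<^esub>) J" by (rule J.rcos_ring_hom_ring)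
    show "surjective_ring_hom_axioms (S Quot J) ((+>\<^bsub>S\<^esub>) J)"
    proof
      show "range ((+>\<^bsub>S\<^esub>) J) = carrier (S Quot J)"
        by (auto simp: FactRing_def A_RCOSETS_def' S_simps)
    qed (use hom.hom_add hom.hom_mult hom.hom_one in \<open>simp_all add: S_simps\<close>)
  qed
  have "J +>\<^bsub>S\<^esub> x = J \<longleftrightarrow> x \<in> J"
    using J.rcos_const_imp_mem[of x] S.a_rcos_zero[OF J.ideal_axioms, of x] by (auto simp: S_simps)
  thus "a_r_coset ring_of_type_algebra J x = \<zero>\<^bsub>quadric_ring\<^esub> \<longleftrightarrow> quadric dvd x"
    unfolding R S_def[symmetric] by (simp add: FactRing_def J_iff)
qed

lemma fps_is_unit:
  fixes f :: "'b::comm_ring_1 fps"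
  assumes "f $ 0 dvd 1"
  shows "f dvd 1"
proof -
  obtain c where c: "1 = f $ 0 * c" using assms ..
  show ?thesis
    by (rule dvdI[OF fps_right_inverse[OF c[symmetric], symmetric]])
qed

lemma quadric_ring_F_rational:
  assumes "CHAR('a::field) > 0" "odd CHAR('a)"
  shows "F_rational (quadric_ring :: 'a fps fps fps set ring) CHAR('a)"
proof -
  define R where "R = (quadric_ring :: 'a fps fps fps set ring)"
  define J where "J = Idl\<^bsub>ring_of_type_algebra\<^esub> {quadric :: 'a fps fps fps}"
  define \<pi> where "\<pi> = a_r_coset ring_of_type_algebra J"
  have zero_iff: "\<pi> x = \<zero>\<^bsub>R\<^esub> \<longleftrightarrow> quadric dvd x" for x
    unfolding \<pi>_def R_def J_def by (rule quadric_ring_surjective_ring_hom)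
  interpret surjective_ring_hom R \<pi>
    unfolding \<pi>_def R_def J_def by (rule quadric_ring_surjective_ring_hom)
  have eq_iff: "\<pi> x = \<pi> y \<longleftrightarrow> quadric dvd x - y" for x y
    using zero_iff[of "x - y"] by (simp add: hom_diff)
  have const_quadric: "quadric $ 0 $ 0 $ 0 = (0 :: 'a)"
    by (simp add: quadric_altdef sum_squares_XY_def)
  \<comment> \<open>This one criterion gives that \<open>R\<close> is nonzero, that its maximal
    ideal is proper and that the characteristic does not drop.\<close>
  have not_dvd: "\<not> quadric dvd x" if "x $ 0 $ 0 $ 0 \<noteq> 0" for x :: "'a fps fps fps"
    using that const_quadric by (auto elim!: dvdE)
  have one_neq: "\<one>\<^bsub>R\<^esub> \<noteq> \<zero>\<^bsub>R\<^esub>"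
    using zero_iff[of 1] not_dvd[of 1] by (simp add: hom_one)
  have "strongly_F_regular_image_axioms R \<pi> CHAR('a)"
  proof
    fix c assume "\<pi> c \<noteq> \<zero>\<^bsub>R\<^esub>"
    thus "\<exists>N. \<forall>e\<ge>N. \<exists>T. frobenius_linear (CHAR('a) ^ e) T \<and>
      (\<forall>x. \<pi> x = \<zero>\<^bsub>R\<^esub> \<longrightarrow> \<pi> (T x) = \<zero>\<^bsub>R\<^esub>) \<and> \<pi> (T c) = \<one>\<^bsub>R\<^esub>"
      using quadric_strongly_F_regular[OF assms, of c]
      by (simp add: zero_iff hom_one[symmetric] eq_iff)
  qed (use assms one_neq in auto)
  then interpret strongly_F_regular_image R \<pi> "CHAR('a)"
    by (intro strongly_F_regular_image.intro surjective_ring_hom_axioms)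
  have "noetherian_ring R"
    by (intro noetherian_ring_image noetherian_type_fps noetherian_type_field)
  moreover have "local_ring R"
  proof (rule local_ring_image)
    show "mult_module.subspace {x :: 'a fps fps fps. x $ 0 $ 0 $ 0 = 0}"
      by (auto simp: mult_module.subspace_def)
    show "x dvd 1" if "x \<notin> {x. x $ 0 $ 0 $ 0 = 0}" for x :: "'a fps fps fps"
      using that by (auto intro!: fps_is_unit simp: dvd_field_iff)
    show "\<one>\<^bsub>R\<^esub> \<notin> \<pi> ` {x. x $ 0 $ 0 $ 0 = 0}"
      using not_dvd by (auto simp: eq_iff simp flip: hom_one)
  qed
  moreover have "Factorial_Ring.prime CHAR('a)"
    using assms(1) by (rule prime_CHAR_semidom)
  moreover have "has_char R CHAR('a)"
    unfolding has_char_def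
  proof
    fix n :: nat
    have "quadric dvd (of_nat n :: 'a fps fps fps) \<longleftrightarrow> (of_nat n :: 'a) = 0"
      using not_dvd[of "of_nat n"] by (auto simp: fps_of_nat[symmetric] of_nat_eq_0_iff_char_dvd)
    thus "[n] \<cdot>\<^bsub>R\<^esub> \<one>\<^bsub>R\<^esub> = \<zero>\<^bsub>R\<^esub> \<longleftrightarrow> CHAR('a) dvd n"
      by (simp add: zero_iff of_nat_eq_0_iff_char_dvd flip: hom_of_nat)
  qed
  moreover have "tight_closure R CHAR('a) I = I" if "principal_class R I" for I
    using that genideal_ideal tight_closure_ideal by (auto simp: principal_class_def)
  ultimately show ?thesis unfolding F_rational_def R_def by blast
qed

theorem proposition5p7:
  fixes p :: nat
  assumes "infinite (UNIV :: 'a::field set)"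
    and "CHAR('a) = p" and "p > 0" and "\<not> p dvd 2"
  shows "F_rational (quadric_ring :: 'a fps fps fps set ring) p"
proof -
  have "Factorial_Ring.prime CHAR('a)"
    using assms by (intro prime_CHAR_semidom) simp
  \<comment> \<open>An even prime would be 2, which divides 2.\<close>
  hence "odd CHAR('a)"
    using assms primes_dvd_imp_eq[OF two_is_prime_nat, of "CHAR('a)"] by fastforce
  thus ?thesis using quadric_ring_F_rational[where 'a = 'a] assms by simp
qed

end
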